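(* Let $k$ be a field, let $\Delta$ be a simplicial complex on $[n]$, and let $k[\Delta]$ be the standard $\mathbb{Z}$-graded Stanley-Reisner ring of $\Delta$. Every $\mathbb{Z}$-graded algebra retract of $k[\Delta]$ is isomorphic, as a $\mathbb{Z}$-graded $k$-algebra, to one of the rings $k[\Delta_W]$, where $W$ is a subset of $[n]$.
   Context: All rings are Noetherian, commutative with unit, and nonzero. A simplicial complex $\Delta$ on a finite vertex set $V$ (here $V=[n]=\{1,\dots,n\}$) is a nonempty set of subsets of $V$ such that $\{i\}\in\Delta$ for all $i\in V$ and every subset of an element of $\Delta$ is in $\Delta$. Its Stanley-Reisner ring over $k$ is $k[\Delta]=k[x_i: i\in V]/I_\Delta$, where $I_\Delta$ is generated by all monomials $x^a$ with $\operatorname{supp}(a)=\{j:a_j\ne0\}\notin\Delta$; it is graded with $\deg x_i=1$. For $W\subseteq V$, the restriction is $\Delta_W=\{D\in\Delta: D\subseteq W\}$, a simplicial complex on the vertex set $W$ (for $W=\emptyset$, $\Delta_W=\{\emptyset\}$ and $k[\Delta_W]=k$). A graded algebra retract of a graded $k$-algebra $B$ is a graded $k$-algebra $R$ together with degree-preserving $k$-algebra homomorphisms $\theta:R\to B$ and $\phi:B\to R$ such that $\phi\circ\theta=\mathrm{id}_R$. *)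

theory Defs
  imports
    "HOL-Algebra.Algebraic_Closure_Type"
    "HOL-Algebra.QuotRing"
    "HOL-Algebra.Module"
    "HOL-Algebra.Ring_Divisibility"
    "HOL-Library.Poly_Mapping"
begin

section \<open>Graded algebras and retracts\<close>

record ('k, 'a) graded_module = "('k, 'a) module" +
  homog :: "int \<Rightarrow> 'a set"

text \<open>
  The component \<open>homog A d\<close> is the degree \<open>d\<close> part. The components are subspaces, so scalars
  act with degree \<open>0\<close>; \<open>decomp\<close> says that the carrier is their internal direct sum.
\<close>

locale graded_algebra = algebra K A for K :: "'k ring" and A :: "('k, 'a) graded_module" (structure) +
  assumes homog_submodule: "submodule (homog A d) K A"
    and homog_mult:
      "x \<in> homog A d \<Longrightarrow> y \<in> homog A e \<Longrightarrow> x \<otimes>\<^bsub>A\<^esub> y \<in> homog A (d + e)"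
    and homog_one: "\<one>\<^bsub>A\<^esub> \<in> homog A 0"
    and decomp: "x \<in> carrier A \<Longrightarrow>
      \<exists>!f. (\<forall>d. f d \<in> homog A d) \<and> finite {d. f d \<noteq> \<zero>\<^bsub>A\<^esub>} \<and>
        x = (\<Oplus>\<^bsub>A\<^esub>d\<in>{d. f d \<noteq> \<zero>\<^bsub>A\<^esub>}. f d)"

definition graded_alg_hom ::
    "'k ring \<Rightarrow> ('k, 'a) graded_module \<Rightarrow> ('k, 'b) graded_module \<Rightarrow> ('a \<Rightarrow> 'b) set" where
  "graded_alg_hom K A B =
    {f \<in> ring_hom A B.
      (\<forall>c \<in> carrier K. \<forall>x \<in> carrier A. f (c \<odot>\<^bsub>A\<^esub> x) = c \<odot>\<^bsub>B\<^esub> f x) \<and>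
      (\<forall>d. \<forall>x \<in> homog A d. f x \<in> homog B d)}"

definition graded_alg_isomorphic ::
    "'k ring \<Rightarrow> ('k, 'a) graded_module \<Rightarrow> ('k, 'b) graded_module \<Rightarrow> bool" where
  "graded_alg_isomorphic K A B \<longleftrightarrow>
    (\<exists>f \<in> graded_alg_hom K A B. \<exists>g \<in> graded_alg_hom K B A.
      (\<forall>x \<in> carrier A. g (f x) = x) \<and> (\<forall>y \<in> carrier B. f (g y) = y))"

definition graded_alg_retract ::
    "'k ring \<Rightarrow> ('k, 'a) graded_module \<Rightarrow> ('k, 'b) graded_module \<Rightarrow> bool" where
  "graded_alg_retract K R B \<longleftrightarrow>
    graded_algebra K R \<and>
    (\<exists>\<theta> \<in> graded_alg_hom K R B. \<exists>\<phi> \<in> graded_alg_hom K B R.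
      \<forall>x \<in> carrier R. \<phi> (\<theta> x) = x)"


section \<open>Stanley-Reisner rings\<close>

definition simplicial_complex_on :: "'v set \<Rightarrow> 'v set set \<Rightarrow> bool" where
  "simplicial_complex_on V \<Delta> \<longleftrightarrow>
    finite V \<and> \<Delta> \<noteq> {} \<and> (\<forall>D \<in> \<Delta>. D \<subseteq> V) \<and> (\<forall>i \<in> V. {i} \<in> \<Delta>) \<and>
    (\<forall>D \<in> \<Delta>. \<forall>E. E \<subseteq> D \<longrightarrow> E \<in> \<Delta>)"

definition complex_restrict :: "'v set set \<Rightarrow> 'v set \<Rightarrow> 'v set set" where
  "complex_restrict \<Delta> W = {D \<in> \<Delta>. D \<subseteq> W}"

text \<open>
  A polynomial is a finitely supported family of coefficients indexed by exponent vectors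
  \<open>'v \<Rightarrow>\<^sub>0 nat\<close>, which are themselves finitely supported. The field is a type \<open>'k\<close>;
  \<open>ring_of_type_algebra\<close> is the type-class ring structure packaged as a record. The subring
  \<open>mpoly_ring V\<close> consists of the polynomials in the variables from \<open>V\<close> only.
\<close>

type_synonym ('v, 'k) mpoly = "('v \<Rightarrow>\<^sub>0 nat) \<Rightarrow>\<^sub>0 'k"

definition mpoly_ring :: "'v set \<Rightarrow> ('v, 'k::field) mpoly ring" where
  "mpoly_ring V = ring_of_type_algebra
    \<lparr>carrier := {p. \<forall>a \<in> Poly_Mapping.keys p. Poly_Mapping.keys a \<subseteq> V}\<rparr>"

definition total_degree :: "('v \<Rightarrow>\<^sub>0 nat) \<Rightarrow> nat" where
  "total_degree a = (\<Sum>i \<in> Poly_Mapping.keys a. Poly_Mapping.lookup a i)"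

definition homogeneous_mpoly :: "int \<Rightarrow> ('v, 'k::field) mpoly \<Rightarrow> bool" where
  "homogeneous_mpoly d p \<longleftrightarrow> (\<forall>a \<in> Poly_Mapping.keys p. int (total_degree a) = d)"

definition sr_ideal :: "'v set \<Rightarrow> 'v set set \<Rightarrow> ('v, 'k::field) mpoly set" where
  "sr_ideal V \<Delta> =
    Idl\<^bsub>mpoly_ring V\<^esub> {Poly_Mapping.single a 1 | a. Poly_Mapping.keys a \<subseteq> V \<and>
      Poly_Mapping.keys a \<notin> \<Delta>}"

text \<open>
  Elements are the cosets of the Stanley-Reisner ideal; the degree \<open>d\<close> part consists of the
  cosets of polynomials that are homogeneous of degree \<open>d\<close>.
\<close>

definition sr_ring ::
    "'v set \<Rightarrow> 'v set set \<Rightarrow> ('k::field, ('v, 'k) mpoly set) graded_module" where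
  "sr_ring V \<Delta> =
    (let P = mpoly_ring V; I = sr_ideal V \<Delta>; Q = P Quot I in
      \<lparr>carrier = carrier Q, monoid.mult = (\<otimes>\<^bsub>Q\<^esub>), one = \<one>\<^bsub>Q\<^esub>,
       zero = \<zero>\<^bsub>Q\<^esub>, add = (\<oplus>\<^bsub>Q\<^esub>),
       module.smult = (\<lambda>c y. (I +>\<^bsub>P\<^esub> Poly_Mapping.single 0 c) \<otimes>\<^bsub>Q\<^esub> y),
       homog = (\<lambda>d. {I +>\<^bsub>P\<^esub> p | p. p \<in> carrier P \<and> homogeneous_mpoly d p})\<rparr>)"

end

theory Submission
  imports Defs
begin

text \<open>
  Let \<open>\<theta> : R \<rightarrow> k[\<Delta>]\<close> and \<open>\<phi> : k[\<Delta>] \<rightarrow> R\<close> be the retract maps and let the linear form \<open>l\<^sub>i\<close> represent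
  \<open>\<theta> (\<phi> x\<^sub>i)\<close>. Writing \<open>x\<^sub>i = l\<^sub>i + (x\<^sub>i - l\<^sub>i)\<close> and exchanging one variable at a time, one finds \<open>W\<close> such
  that the \<open>l\<^sub>i\<close> with \<open>i \<in> W\<close> and the \<open>x\<^sub>i - l\<^sub>i\<close> with \<open>i \<notin> W\<close> still span all linear forms. Since
  \<open>\<phi>\<close> kills every \<open>x\<^sub>i - l\<^sub>i\<close>, the composite \<open>\<alpha> : k[\<Delta>\<^sub>W] \<rightarrow> k[\<Delta>] \<rightarrow> R\<close> is onto; since the restriction
  \<open>k[\<Delta>] \<rightarrow> k[\<Delta>\<^sub>W]\<close> kills \<open>x\<^sub>i\<close> for \<open>i \<notin> W\<close>, the composite \<open>\<beta> : R \<rightarrow> k[\<Delta>] \<rightarrow> k[\<Delta>\<^sub>W]\<close> is onto in every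
  degree. Then \<open>\<alpha> \<circ> \<beta>\<close> is a surjective endomorphism of the Noetherian ring \<open>R\<close>, hence injective, and
  \<open>\<beta>\<close> is an isomorphism.
\<close>

section \<open>Exchanging sums for one of their summands in a spanning set\<close>

text \<open>The coefficient \<open>k\<close> of \<open>a + b\<close> in the expansion of
  \<open>a\<close> decides. If \<open>k = 0\<close>, then \<open>a\<close> already lies in the span
  of \<open>H\<close>, and adjoining \<open>b\<close> gives the sum. Otherwise dividing by
  \<open>k\<close> expresses the sum through \<open>a\<close> and \<open>H\<close>.\<close>

lemma (in vector_space) span_exchange_summand:
  assumes "a \<in> span (insert (a + b) H)"
  shows "a + b \<in> span (insert a H) \<or> a + b \<in> span (insert b H)"
proof -
  obtain k where k: "a - scale k (a + b) \<in> span H"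
    using assms by (auto simp: span_breakdown_eq)
  show ?thesis
  proof (cases "k = 0")
    case True
    then have "a \<in> span (insert b H)"
      using k span_mono[of H "insert b H"] by auto
    then show ?thesis
      by (simp add: span_add span_base)
  next
    case False
    have "a - (a - scale k (a + b)) \<in> span (insert a H)"
      by (rule span_diff[OF span_base[OF insertI1] subsetD[OF span_mono[OF subset_insertI] k]])
    then have "scale (inverse k) (scale k (a + b)) \<in> span (insert a H)"
      by (intro span_scale[of "scale k (a + b)"]) simp
    then show ?thesis
      using False by simp
  qed
qed

text \<open>Induction on \<open>S\<close>, treating one index \<open>m\<close> at a time with the
  remaining sums held fixed. The summand \<open>c\<close> chosen for \<open>m\<close> is moved into
  \<open>H\<close>, which is why \<open>H\<close> has to vary in the induction.\<close>

lemma (in vector_space) span_exchange_summands: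
  assumes "finite S"
    and "\<And>i. i \<in> S \<Longrightarrow> a i \<in> span ((\<lambda>i. a i + b i) ` S \<union> H)"
  shows "\<exists>W \<subseteq> S. (\<lambda>i. a i + b i) ` S \<union> H \<subseteq> span (a ` W \<union> b ` (S - W) \<union> H)"
  using assms
proof (induction S arbitrary: H rule: finite_induct)
  case empty
  then show ?case
    by (auto intro: span_base)
next
  case (insert m S)
  let ?u = "\<lambda>i. a i + b i" and ?H0 = "(\<lambda>i. a i + b i) ` S \<union> H"
  have full: "?u ` insert m S \<union> H = insert (?u m) ?H0"
    by auto
  have "a m \<in> span (insert (?u m) ?H0)"
    using insert.prems[of m] full by auto
  from span_exchange_summand[OF this] obtain c
    where c: "c = a m \<or> c = b m" "?u m \<in> span (insert c ?H0)"
    by blast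
  \<comment> \<open>Replacing the sum of \<open>m\<close> by \<open>c\<close> does not shrink the
    span, so the assumption on the remaining \<open>a i\<close> survives and the induction
    hypothesis applies to \<open>insert c H\<close>.\<close>
  have sub: "span (insert (?u m) ?H0) \<subseteq> span (insert c ?H0)"
    using c(2) by (intro span_minimal) (auto intro: span_base)
  have c_eq: "insert c ?H0 = ?u ` S \<union> insert c H"
    by auto
  have "\<exists>W\<subseteq>S. ?u ` S \<union> insert c H \<subseteq> span (a ` W \<union> b ` (S - W) \<union> insert c H)"
  proof (rule insert.IH)
    fix i assume "i \<in> S"
    then have "a i \<in> span (insert (?u m) ?H0)"
      using insert.prems[of i] unfolding full by simp
    then show "a i \<in> span (?u ` S \<union> insert c H)"
      using sub unfolding c_eq by (rule subsetD[rotated])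
  qed
  then obtain W where W: "W \<subseteq> S" "insert c ?H0 \<subseteq> span (a ` W \<union> b ` (S - W) \<union> insert c H)"
    unfolding c_eq by blast
  have sub': "?u ` insert m S \<union> H \<subseteq> span (a ` W \<union> b ` (S - W) \<union> insert c H)"
  proof -
    have "insert (?u m) ?H0 \<subseteq> span (insert c ?H0)"
      using sub span_superset by (rule subset_trans[rotated])
    also have "\<dots> \<subseteq> span (a ` W \<union> b ` (S - W) \<union> insert c H)"
      by (intro span_minimal W(2) subspace_span)
    finally show ?thesis
      unfolding full .
  qed
  \<comment> \<open>The choice \<open>c = a m\<close> puts \<open>m\<close> into \<open>W\<close>;
    the choice \<open>c = b m\<close> leaves it in the complement.\<close>
  show ?case
    using c(1)
  proof
    assume "c = a m"
    moreover have "insert m S - insert m W = S - W"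
      using insert.hyps W(1) by auto
    ultimately have "a ` W \<union> b ` (S - W) \<union> insert c H
        = a ` insert m W \<union> b ` (insert m S - insert m W) \<union> H"
      by auto
    then show ?thesis
      using sub' W(1) by (metis insert_mono)
  next
    assume "c = b m"
    moreover have "insert m S - W = insert m (S - W)"
      using insert.hyps W(1) by auto
    ultimately have "a ` W \<union> b ` (S - W) \<union> insert c H = a ` W \<union> b ` (insert m S - W) \<union> H"
      by auto
    then show ?thesis
      using sub' W(1) by (metis subset_insertI2)
  qed
qed

section \<open>Surjective endomorphisms of Noetherian rings\<close>

text \<open>The kernels of the iterates \<open>f ^^ m\<close> form an ascending chain of ideals,
  which stops at some \<open>m\<close>. If \<open>f x = \<zero>\<close>, surjectivity gives
  \<open>x = (f ^^ m) y\<close>; then \<open>y\<close> is in the kernel of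
  \<open>f ^^ Suc m\<close>, hence in that of \<open>f ^^ m\<close>, so
  \<open>x = \<zero>\<close>.\<close>

lemma (in noetherian_ring) surj_ring_endomorphism_inj:
  assumes f: "f \<in> ring_hom R R" and surj: "f ` carrier R = carrier R"
  shows "inj_on f (carrier R)"
proof -
  have hom: "ring_hom_ring R R (f ^^ m)" for m
  proof (induction m)
    case 0
    then show ?case
      by (intro ring_hom_ringI2 ring_axioms ring_hom_memI) auto
  next
    case (Suc m)
    then have "f \<circ> (f ^^ m) \<in> ring_hom R R"
      using f by (auto intro!: ring_hom_trans simp: ring_hom_ring_def ring_hom_ring_axioms_def)
    then show ?case
      by (intro ring_hom_ringI2 ring_axioms) (simp add: comp_def)
  qed
  have surj_pow: "(f ^^ m) ` carrier R = carrier R" for m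
    proof (induction m)
    case (Suc m)
    then show ?case
      using surj by (simp flip: image_image)
  qed simp
  define I where "I m = a_kernel R R (f ^^ m)" for m
  have I_iff: "x \<in> I m \<longleftrightarrow> x \<in> carrier R \<and> (f ^^ m) x = \<zero>" for x m
    by (auto simp: I_def a_kernel_def')
  have f0: "f \<zero> = \<zero>"
    using f by (rule ring_hom_zero) (rule ring_axioms)+
  have I_Suc: "I m \<subseteq> I (Suc m)" for m
    by (simp add: subset_iff I_iff f0)
  have "subset.chain {J. ideal J R} (range I)"
  proof -
    have "I m \<subseteq> I m' \<or> I m' \<subseteq> I m" for m m'
      using lift_Suc_mono_le[of I, OF I_Suc] nat_le_linear[of m m'] by blast
    moreover have "ideal (I m) R" for m
      unfolding I_def by (rule ring_hom_ring.kernel_is_ideal[OF hom])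
    ultimately show ?thesis
      by (auto simp: subset_chain_def)
  qed
  \<comment> \<open>In a Noetherian ring a nonempty chain of ideals contains its own union; the
    index of that member is where the kernels stop growing.\<close>
  then have "\<Union> (range I) \<in> range I"
    by (intro ideal_chain_is_trivial) auto
  then obtain m where "\<Union> (range I) = I m"
    by blast
  then have m: "I (Suc m) \<subseteq> I m"
    by blast
  have "a_kernel R R f = {\<zero>}"
  proof -
    have "x = \<zero>" if x: "x \<in> carrier R" "f x = \<zero>" for x
    proof -
      obtain y where y: "y \<in> carrier R" "x = (f ^^ m) y"
        using surj_pow[of m] x(1) by blast
      then have "y \<in> I (Suc m)"
        using x(2) by (simp add: I_iff)
      then show ?thesis
        using m y(2) by (auto simp: I_iff)
    qed
    then show ?thesis
      using f0 by (auto simp: a_kernel_def')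
  qed
  then show ?thesis
    using ring_hom_ring.trivial_ker_imp_inj hom[of 1] by simp
qed

section \<open>Polynomials, monomials and degrees\<close>

text \<open>Natural number exponents cannot cancel, so the supports satisfy an equality and not
  merely an inclusion.\<close>

lemma keys_add_nat: "Poly_Mapping.keys (a + b :: 'v \<Rightarrow>\<^sub>0 nat) = Poly_Mapping.keys a \<union> Poly_Mapping.keys b"
  by (auto simp: in_keys_iff lookup_add)

lemma carrier_mpoly_ring:
  "carrier (mpoly_ring V) = {p :: ('v, 'k::field) mpoly. \<forall>a \<in> Poly_Mapping.keys p. Poly_Mapping.keys a \<subseteq> V}"
  by (simp add: mpoly_ring_def)

lemma mpoly_ring_simps [simp]:
  "monoid.mult (mpoly_ring V) = (\<lambda>p q :: ('v, 'k::field) mpoly. p * q)"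
  "monoid.one (mpoly_ring V) = (1 :: ('v, 'k) mpoly)"
  "ring.add (mpoly_ring V) = (\<lambda>p q :: ('v, 'k::field) mpoly. p + q)"
  "ring.zero (mpoly_ring V) = (0 :: ('v, 'k) mpoly)"
  by (simp_all add: mpoly_ring_def ring_of_type_algebra_def)

lemma ring_of_type_algebra_simps [simp]:
  "carrier (ring_of_type_algebra :: 'k::field ring) = UNIV"
  "monoid.mult ring_of_type_algebra = (\<lambda>p q :: 'k::field. p * q)"
  "monoid.one ring_of_type_algebra = (1 :: 'k)"
  "ring.add ring_of_type_algebra = (\<lambda>p q :: 'k. p + q)"
  "ring.zero ring_of_type_algebra = (0 :: 'k)"
  by (simp_all add: ring_of_type_algebra_def)

text \<open>Scalars act through constant polynomials. This provides \<open>mpoly.span\<close> and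
  \<open>mpoly.subspace\<close>, in which the exchange argument is carried out.\<close>

interpretation mpoly: vector_space
  "\<lambda>(c :: 'k::field) (p :: ('v, 'k) mpoly). Poly_Mapping.single 0 c * p"
  by unfold_locales (simp_all add: algebra_simps single_add mult_single flip: mult.assoc)

lemma monomial_in_mpoly_ring:
  "Poly_Mapping.keys a \<subseteq> V \<Longrightarrow> Poly_Mapping.single a c \<in> carrier (mpoly_ring V)"
  by (simp add: carrier_mpoly_ring)

lemma mpoly_ring_closed:
  fixes p q :: "('v, 'k::field) mpoly"
  assumes "p \<in> carrier (mpoly_ring V)" "q \<in> carrier (mpoly_ring V)"
  shows "p + q \<in> carrier (mpoly_ring V)" "p * q \<in> carrier (mpoly_ring V)"
    "- p \<in> carrier (mpoly_ring V)" "p - q \<in> carrier (mpoly_ring V)"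
proof -
  have *: "r + s \<in> carrier (mpoly_ring V)"
    if "r \<in> carrier (mpoly_ring V)" "s \<in> carrier (mpoly_ring V)" for r s :: "('v, 'k) mpoly"
    using that Poly_Mapping.keys_add[of r s] by (fastforce simp: carrier_mpoly_ring)
  show "p + q \<in> carrier (mpoly_ring V)"
    by (rule *[OF assms])
  show "p * q \<in> carrier (mpoly_ring V)"
    using assms keys_mult[of p q] by (fastforce simp: carrier_mpoly_ring keys_add_nat)
  have neg: "- r \<in> carrier (mpoly_ring V)"
    if "r \<in> carrier (mpoly_ring V)" for r :: "('v, 'k) mpoly"
    using that by (simp add: carrier_mpoly_ring)
  show "- p \<in> carrier (mpoly_ring V)"
    by (rule neg[OF assms(1)])
  show "p - q \<in> carrier (mpoly_ring V)"
    using *[OF assms(1) neg[OF assms(2)]] by simp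
qed

lemma cring_mpoly_ring: "cring (mpoly_ring V :: ('v, 'k::field) mpoly ring)"
proof (intro cringI abelian_groupI comm_monoidI)
  fix p :: "('v, 'k) mpoly" assume "p \<in> carrier (mpoly_ring V)"
  then show "\<exists>q\<in>carrier (mpoly_ring V). q \<oplus>\<^bsub>mpoly_ring V\<^esub> p = \<zero>\<^bsub>mpoly_ring V\<^esub>"
    using mpoly_ring_closed(3)[of p V] by (intro bexI[of _ "- p"]) simp_all
qed (simp_all add: mpoly_ring_closed algebra_simps, simp_all add: carrier_mpoly_ring)

lemma a_minus_mpoly_ring:
  fixes p q :: "('v, 'k::field) mpoly"
  assumes "p \<in> carrier (mpoly_ring V)" "q \<in> carrier (mpoly_ring V)"
  shows "p \<ominus>\<^bsub>mpoly_ring V\<^esub> q = p - q"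
proof -
  interpret cring "mpoly_ring V :: ('v, 'k) mpoly ring"
    by (rule cring_mpoly_ring)
  have "\<ominus>\<^bsub>mpoly_ring V\<^esub> q = - q"
    using assms(2) mpoly_ring_closed(3)[OF assms(2)] by (intro minus_equality) simp_all
  then show ?thesis
    by (simp add: a_minus_def)
qed

lemma mpoly_eq_sum_monomials:
  "(\<Sum>a \<in> Poly_Mapping.keys p. Poly_Mapping.single a (Poly_Mapping.lookup p a)) = p"
  by (rule poly_mapping_eqI)
    (simp add: lookup_sum lookup_single when_def sum.delta in_keys_iff)

lemma mpoly_in_span_monomials:
  "(p :: ('v, 'k::field) mpoly) \<in> mpoly.span ((\<lambda>a. Poly_Mapping.single a 1) ` Poly_Mapping.keys p)"
proof -
  have "(\<Sum>a \<in> Poly_Mapping.keys p.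
      Poly_Mapping.single 0 (Poly_Mapping.lookup p a) * Poly_Mapping.single a 1)
    \<in> mpoly.span ((\<lambda>a. Poly_Mapping.single a 1) ` Poly_Mapping.keys p)"
    by (intro mpoly.span_sum mpoly.span_scale mpoly.span_base imageI)
  then show ?thesis
    by (simp add: mult_single mpoly_eq_sum_monomials)
qed

lemma total_degree_single: "total_degree (Poly_Mapping.single i m) = m"
  by (simp add: total_degree_def)

lemma total_degree_add: "total_degree (a + b) = total_degree a + total_degree b"
proof -
  \<comment> \<open>The three exponents have different supports; summing over a common finite
    superset adds only zeros and makes the sums comparable.\<close>
  have "(\<Sum>i\<in>A. Poly_Mapping.lookup c i) = total_degree c"
    if "finite A" "Poly_Mapping.keys c \<subseteq> A" for A and c :: "'a \<Rightarrow>\<^sub>0 nat"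
    unfolding total_degree_def using that
    by (intro sum.mono_neutral_right) (auto simp: in_keys_iff)
  from this[of "Poly_Mapping.keys a \<union> Poly_Mapping.keys b"] show ?thesis
    by (simp add: total_degree_def[of "a + b"] keys_add_nat lookup_add sum.distrib)
qed

lemma total_degree_eq_0_iff: "total_degree a = 0 \<longleftrightarrow> a = 0"
proof
  assume "total_degree a = 0"
  then have "Poly_Mapping.lookup a i = 0" for i
    by (cases "i \<in> Poly_Mapping.keys a") (simp_all add: total_degree_def in_keys_iff)
  then show "a = 0"
    by (intro poly_mapping_eqI) simp
qed (simp add: total_degree_def)

text \<open>Builds a monomial one variable at a time, by induction on the total degree.\<close>

lemma exponent_induct [consumes 1, case_names zero add]:
  fixes a :: "'v \<Rightarrow>\<^sub>0 nat"
  assumes "Poly_Mapping.keys a \<subseteq> V" "P 0"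
    and "\<And>a i. i \<in> V \<Longrightarrow> Poly_Mapping.keys a \<subseteq> V \<Longrightarrow> P a \<Longrightarrow> P (Poly_Mapping.single i 1 + a)"
  shows "P a"
  using assms(1)
proof (induction "total_degree a" arbitrary: a)
  case 0
  then have "a = 0"
    by (simp flip: total_degree_eq_0_iff)
  then show ?case
    using assms(2) by simp
next
  case (Suc d)
  then have "Poly_Mapping.keys a \<noteq> {}"
    unfolding total_degree_def by (metis nat.distinct(1) sum.empty)
  then obtain i where i: "i \<in> Poly_Mapping.keys a"
    by blast
  \<comment> \<open>Subtraction of exponents is truncated at zero; it can be undone here because
    \<open>i\<close> is in the support of \<open>a\<close>.\<close>
  define b where "b = a - Poly_Mapping.single i 1"
  have a: "a = Poly_Mapping.single i 1 + b"
    using i by (intro poly_mapping_eqI)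
      (auto simp: b_def lookup_add lookup_minus lookup_single when_def in_keys_iff)
  then show ?case
    using Suc assms(3)[of i b] i by (simp add: total_degree_add total_degree_single keys_add_nat)
qed

text \<open>An exponent of total degree 1 is a single variable: it is not zero, and once a variable
  is split off, degree 0 remains.\<close>

lemma linear_form_in_span_variables:
  fixes p :: "('v, 'k::field) mpoly"
  assumes "p \<in> carrier (mpoly_ring V)" "homogeneous_mpoly 1 p"
  shows "p \<in> mpoly.span ((\<lambda>i. Poly_Mapping.single (Poly_Mapping.single i 1) 1) ` V)"
proof -
  have "a \<in> (\<lambda>i. Poly_Mapping.single i 1) ` V" if "a \<in> Poly_Mapping.keys p" for a
  proof -
    have "Poly_Mapping.keys a \<subseteq> V" "total_degree a = 1"
      using assms that by (auto simp: carrier_mpoly_ring homogeneous_mpoly_def)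
    then show ?thesis
    proof (induction rule: exponent_induct)
      case zero
      then show ?case by (simp add: total_degree_def)
    next
      case (add a i)
      have "a = 0" 
        using add.prems
        by (simp add: total_degree_add total_degree_single total_degree_eq_0_iff)
      then show ?case
        using add.hyps by simp
    qed
  qed
  then have "(\<lambda>a. Poly_Mapping.single a 1) ` Poly_Mapping.keys p
      \<subseteq> (\<lambda>i. Poly_Mapping.single (Poly_Mapping.single i 1) (1 :: 'k)) ` V"
    by blast
  then show ?thesis
    using mpoly_in_span_monomials[of p] mpoly.span_mono by blast
qed

section \<open>Stanley-Reisner rings as quotients and maps between them\<close>

abbreviation sr_class :: "'v set \<Rightarrow> 'v set set \<Rightarrow> ('v, 'k::field) mpoly \<Rightarrow> ('v, 'k) mpoly set" where
  "sr_class V \<Delta> p \<equiv> sr_ideal V \<Delta> +>\<^bsub>mpoly_ring V\<^esub> p"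

lemma sr_ideal_is_ideal: "ideal (sr_ideal V \<Delta>) (mpoly_ring V :: ('v, 'k::field) mpoly ring)"
  unfolding sr_ideal_def
  by (intro ring.genideal_ideal cring.axioms(1) cring_mpoly_ring) (auto intro: monomial_in_mpoly_ring)

lemma nonface_monomial_in_sr_ideal:
  assumes "Poly_Mapping.keys a \<subseteq> V" "Poly_Mapping.keys a \<notin> \<Delta>"
  shows "Poly_Mapping.single a (1 :: 'k::field) \<in> sr_ideal V \<Delta>"
  unfolding sr_ideal_def
  by (rule subsetD[OF ring.genideal_self])
    (use assms in \<open>auto intro: monomial_in_mpoly_ring cring.axioms(1) cring_mpoly_ring\<close>)

lemma carrier_sr_ring: "carrier (sr_ring V \<Delta>) = sr_class V \<Delta> ` carrier (mpoly_ring V)"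
  by (auto simp: sr_ring_def Let_def FactRing_def A_RCOSETS_def RCOSETS_def a_r_coset_def)

lemma homog_sr_ring:
  "homog (sr_ring V \<Delta>) d =
    {sr_class V \<Delta> p | p. p \<in> carrier (mpoly_ring V) \<and> homogeneous_mpoly d p}"
  by (simp add: sr_ring_def Let_def)

lemma sr_class_hom: "sr_class V \<Delta> \<in> ring_hom (mpoly_ring V) (sr_ring V \<Delta>)"
  using ring_hom_memE[OF ideal.rcos_ring_hom[OF sr_ideal_is_ideal[of V \<Delta>]]]
  by (intro ring_hom_memI) (simp_all add: sr_ring_def Let_def)

lemma sr_ring_smult:
  assumes "p \<in> carrier (mpoly_ring V)"
  shows "c \<odot>\<^bsub>sr_ring V \<Delta>\<^esub> sr_class V \<Delta> p = sr_class V \<Delta> (Poly_Mapping.single 0 c * p)"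
proof -
  have "Poly_Mapping.single 0 c \<in> carrier (mpoly_ring V)"
    by (rule monomial_in_mpoly_ring) simp
  then show ?thesis
    using ring_hom_mult[OF sr_class_hom[of V \<Delta>] _ assms] by (simp add: sr_ring_def Let_def)
qed

lemma sr_class_eq_iff:
  fixes p q :: "('v, 'k::field) mpoly"
  assumes "p \<in> carrier (mpoly_ring V)" "q \<in> carrier (mpoly_ring V)"
  shows "sr_class V \<Delta> p = sr_class V \<Delta> q \<longleftrightarrow> p - q \<in> sr_ideal V \<Delta>"
  using ring.quotient_eq_iff_same_a_r_cos[OF cring.axioms(1)[OF cring_mpoly_ring]
      sr_ideal_is_ideal[of V \<Delta>] assms]
  by (simp add: a_minus_mpoly_ring[OF assms])

text \<open>The preimage under \<open>f\<close> of the target ideal is an ideal containing the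
  generators of \<open>sr_ideal V \<Delta>\<close>, so \<open>f\<close> descends to the quotients.
  It serves below for both restriction and inclusion.\<close>

lemma induced_sr_hom:
  fixes f :: "('v, 'k::field) mpoly \<Rightarrow> ('w, 'k) mpoly"
  assumes hom: "f \<in> ring_hom (mpoly_ring V) (mpoly_ring W)"
    and const: "\<And>c. f (Poly_Mapping.single 0 c) = Poly_Mapping.single 0 c"
    and homog: "\<And>p d. p \<in> carrier (mpoly_ring V) \<Longrightarrow> homogeneous_mpoly d p \<Longrightarrow> homogeneous_mpoly d (f p)"
    and nonface: "\<And>a. Poly_Mapping.keys a \<subseteq> V \<Longrightarrow> Poly_Mapping.keys a \<notin> \<Delta> \<Longrightarrow>
      f (Poly_Mapping.single a 1) \<in> sr_ideal W \<Gamma>"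
  shows "\<exists>h \<in> graded_alg_hom ring_of_type_algebra (sr_ring V \<Delta>) (sr_ring W \<Gamma>).
    \<forall>p \<in> carrier (mpoly_ring V). h (sr_class V \<Delta> p) = sr_class W \<Gamma> (f p)"
proof -
  let ?P = "mpoly_ring V :: ('v, 'k) mpoly ring" and ?Q = "mpoly_ring W :: ('w, 'k) mpoly ring"
  interpret f: ring_hom_ring ?P ?Q f
    by (intro ring_hom_ringI2 hom cring.axioms(1) cring_mpoly_ring)
  have "sr_ideal V \<Delta> \<subseteq> {p \<in> carrier ?P. f p \<in> sr_ideal W \<Gamma>}"
    unfolding sr_ideal_def[of V]
    by (intro f.R.genideal_minimal f.ideal_vimage sr_ideal_is_ideal)
      (auto intro: monomial_in_mpoly_ring nonface)
  then have ideal: "f p \<in> sr_ideal W \<Gamma>" if "p \<in> sr_ideal V \<Delta>" for p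
    using that by blast
  have diff: "f (p - q) = f p - f q" if "p \<in> carrier ?P" "q \<in> carrier ?P" for p q
  proof -
    have "f (p - q) + f q = f p"
      using f.hom_add[of "p - q" q] mpoly_ring_closed(4)[OF that] that by simp
    then show ?thesis
      by (simp add: algebra_simps)
  qed
  \<comment> \<open>Well-definedness: for each coset \<open>C\<close> one value \<open>Y\<close>
    fits all its representatives, and sets \<open>C\<close> that are no cosets satisfy the claim
    vacuously. Choosing \<open>Y\<close> for every \<open>C\<close> yields \<open>h\<close>.\<close>
  have "\<exists>Y. \<forall>p \<in> carrier ?P. C = sr_class V \<Delta> p \<longrightarrow> Y = sr_class W \<Gamma> (f p)" for C
  proof (cases "C \<in> sr_class V \<Delta> ` carrier ?P")
    case True
    then obtain q where q: "q \<in> carrier ?P" "C = sr_class V \<Delta> q"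
      by blast
    have "sr_class W \<Gamma> (f q) = sr_class W \<Gamma> (f p)"
      if "p \<in> carrier ?P" "C = sr_class V \<Delta> p" for p
      using that q ideal[of "q - p"] by (simp add: sr_class_eq_iff diff)
    then show ?thesis
      by blast
  qed blast
  then obtain h where h: "\<And>p. p \<in> carrier ?P \<Longrightarrow> h (sr_class V \<Delta> p) = sr_class W \<Gamma> (f p)"
    by metis
  have "h \<in> graded_alg_hom ring_of_type_algebra (sr_ring V \<Delta>) (sr_ring W \<Gamma>)"
    unfolding graded_alg_hom_def
  proof (intro CollectI conjI ring_hom_memI ballI allI)
    note P_hom = sr_class_hom[of V \<Delta>] and Q_hom = sr_class_hom[of W \<Gamma>]
    show "h \<one>\<^bsub>sr_ring V \<Delta>\<^esub> = \<one>\<^bsub>sr_ring W \<Gamma>\<^esub>"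
      using ring_hom_one[OF P_hom] ring_hom_one[OF Q_hom] h[of 1] f.hom_one f.R.one_closed
      by (metis mpoly_ring_simps(2))
    show "h x \<in> carrier (sr_ring W \<Gamma>)" if "x \<in> carrier (sr_ring V \<Delta>)"
      for x :: "('v, 'k) mpoly set"
      using that h by (auto simp: carrier_sr_ring)
    fix x :: "('v, 'k) mpoly set"
    assume "x \<in> carrier (sr_ring V \<Delta>)"
    then obtain p where p: "p \<in> carrier ?P" "x = sr_class V \<Delta> p"
      by (auto simp: carrier_sr_ring)
    show "h (c \<odot>\<^bsub>sr_ring V \<Delta>\<^esub> x) = c \<odot>\<^bsub>sr_ring W \<Gamma>\<^esub> h x" for c
    proof -
      have "Poly_Mapping.single 0 c \<in> carrier ?P"
        by (rule monomial_in_mpoly_ring) simp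
      then show ?thesis
        using p f.hom_mult[of "Poly_Mapping.single 0 c" p] f.hom_closed[of p] const
        by (simp add: sr_ring_smult h mpoly_ring_closed)
    qed
    fix y :: "('v, 'k) mpoly set"
    assume "y \<in> carrier (sr_ring V \<Delta>)"
    then obtain q where q: "q \<in> carrier ?P" "y = sr_class V \<Delta> q"
      by (auto simp: carrier_sr_ring)
    have "x \<otimes>\<^bsub>sr_ring V \<Delta>\<^esub> y = sr_class V \<Delta> (p * q)"
      "x \<oplus>\<^bsub>sr_ring V \<Delta>\<^esub> y = sr_class V \<Delta> (p + q)"
      using p q ring_hom_mult[OF P_hom p(1) q(1)] ring_hom_add[OF P_hom p(1) q(1)] by simp_all
    then show "h (x \<otimes>\<^bsub>sr_ring V \<Delta>\<^esub> y) = h x \<otimes>\<^bsub>sr_ring W \<Gamma>\<^esub> h y"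
      and "h (x \<oplus>\<^bsub>sr_ring V \<Delta>\<^esub> y) = h x \<oplus>\<^bsub>sr_ring W \<Gamma>\<^esub> h y"
      using p q f.hom_mult[OF p(1) q(1)] ring_hom_mult[OF Q_hom, of "f p" "f q"]
        f.hom_add[OF p(1) q(1)] ring_hom_add[OF Q_hom, of "f p" "f q"]
      by (simp_all add: h mpoly_ring_closed)
  next
    fix d and x :: "('v, 'k) mpoly set"
    assume "x \<in> homog (sr_ring V \<Delta>) d"
    then show "h x \<in> homog (sr_ring W \<Gamma>) d"
      using h homog f.hom_closed by (fastforce simp: homog_sr_ring)
  qed
  then show ?thesis
    using h by blast
qed

section \<open>Restriction to \<open>W\<close> and inclusion from \<open>W\<close>\<close>

text \<open>This is the substitution that sets the variables outside \<open>W\<close> to zero,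
  described by the terms that survive it.\<close>

definition mpoly_restrict :: "'v set \<Rightarrow> ('v, 'k::field) mpoly \<Rightarrow> ('v, 'k) mpoly" where
  "mpoly_restrict W p = (\<Sum>a | a \<in> Poly_Mapping.keys p \<and> Poly_Mapping.keys a \<subseteq> W.
    Poly_Mapping.single a (Poly_Mapping.lookup p a))"

lemma lookup_mpoly_restrict:
  "Poly_Mapping.lookup (mpoly_restrict W p) a =
    (if Poly_Mapping.keys a \<subseteq> W then Poly_Mapping.lookup p a else 0)"
  by (simp add: mpoly_restrict_def lookup_sum lookup_single when_def sum.delta in_keys_iff)

lemma keys_mpoly_restrict:
  "Poly_Mapping.keys (mpoly_restrict W p) = {a \<in> Poly_Mapping.keys p. Poly_Mapping.keys a \<subseteq> W}"
  by (rule Set.set_eqI) (simp add: in_keys_iff[of _ p] in_keys_iff[of _ "mpoly_restrict W p"]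
      lookup_mpoly_restrict)

lemma mpoly_restrict_add: "mpoly_restrict W (p + q) = mpoly_restrict W p + mpoly_restrict W q"
  by (rule poly_mapping_eqI) (simp add: lookup_mpoly_restrict lookup_add)

lemma mpoly_restrict_eq_0:
  "(\<And>a. a \<in> Poly_Mapping.keys p \<Longrightarrow> \<not> Poly_Mapping.keys a \<subseteq> W) \<Longrightarrow> mpoly_restrict W p = 0"
  by (rule poly_mapping_eqI) (auto simp: lookup_mpoly_restrict in_keys_iff)

lemma mpoly_restrict_id: "p \<in> carrier (mpoly_ring W) \<Longrightarrow> mpoly_restrict W p = p"
  by (rule poly_mapping_eqI) (auto simp: lookup_mpoly_restrict carrier_mpoly_ring in_keys_iff)

lemma mpoly_restrict_closed: "mpoly_restrict W p \<in> carrier (mpoly_ring W)"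
  by (simp add: carrier_mpoly_ring keys_mpoly_restrict)

text \<open>Each factor is its restriction plus a remainder whose monomials all involve a variable
  outside \<open>W\<close>. A product with such a monomial still involves that variable, so only the
  product of the restrictions survives.\<close>

lemma mpoly_restrict_mult:
  "mpoly_restrict W (p * q) = mpoly_restrict W p * mpoly_restrict W q"
proof -
  define p' q' where "p' = p - mpoly_restrict W p" and "q' = q - mpoly_restrict W q"
  have p': "\<not> Poly_Mapping.keys a \<subseteq> W" if "a \<in> Poly_Mapping.keys p'" for a
    using that by (auto simp: p'_def in_keys_iff lookup_minus lookup_mpoly_restrict)
  have q': "\<not> Poly_Mapping.keys a \<subseteq> W" if "a \<in> Poly_Mapping.keys q'" for a
    using that by (auto simp: q'_def in_keys_iff lookup_minus lookup_mpoly_restrict)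
  have "mpoly_restrict W (p' * q) = 0"
    using p' keys_mult[of p' q] by (intro mpoly_restrict_eq_0) (fastforce simp: keys_add_nat)
  moreover have "mpoly_restrict W (mpoly_restrict W p * q') = 0"
    using q' keys_mult[of "mpoly_restrict W p" q']
    by (intro mpoly_restrict_eq_0) (fastforce simp: keys_add_nat)
  moreover have "mpoly_restrict W (mpoly_restrict W p * mpoly_restrict W q)
      = mpoly_restrict W p * mpoly_restrict W q"
    by (intro mpoly_restrict_id mpoly_ring_closed mpoly_restrict_closed)
  moreover have "p * q = p' * q + mpoly_restrict W p * q' + mpoly_restrict W p * mpoly_restrict W q"
    by (simp add: p'_def q'_def algebra_simps)
  ultimately show ?thesis
    by (simp add: mpoly_restrict_add)
qed

lemma mpoly_restrict_single:
  "mpoly_restrict W (Poly_Mapping.single a c) =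
    (if Poly_Mapping.keys a \<subseteq> W then Poly_Mapping.single a c else 0)"
  by (rule poly_mapping_eqI) (auto simp: lookup_mpoly_restrict lookup_single when_def)

text \<open>A nonface of \<open>\<Delta>\<close> either leaves \<open>W\<close>, and its monomial
  restricts to zero, or lies in \<open>W\<close> and is a nonface of the restricted complex.\<close>

lemma ex_sr_restriction:
  fixes \<Delta> :: "'v set set"
  shows "\<exists>\<pi> \<in> graded_alg_hom (ring_of_type_algebra :: 'k::field ring)
      (sr_ring V \<Delta>) (sr_ring W (complex_restrict \<Delta> W)).
    \<forall>p \<in> carrier (mpoly_ring V). \<pi> (sr_class V \<Delta> p) = sr_class W (complex_restrict \<Delta> W) (mpoly_restrict W p)"
proof (rule induced_sr_hom)
  show "mpoly_restrict W \<in> ring_hom (mpoly_ring V) (mpoly_ring W)"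
    using mpoly_restrict_single[of W 0 1]
    by (intro ring_hom_memI) (simp_all add: mpoly_restrict_closed mpoly_restrict_mult mpoly_restrict_add)
  show "mpoly_restrict W (Poly_Mapping.single 0 c) = Poly_Mapping.single 0 c" for c :: 'k
    by (simp add: mpoly_restrict_single)
  show "homogeneous_mpoly d (mpoly_restrict W p)" if "homogeneous_mpoly d p" for d and p :: "('v, 'k) mpoly"
    using that by (simp add: homogeneous_mpoly_def keys_mpoly_restrict)
  let ?I = "sr_ideal W (complex_restrict \<Delta> W) :: ('v, 'k) mpoly set"
  have "0 \<in> ?I"
    using additive_subgroup.zero_closed[OF ideal.axioms(1)[OF sr_ideal_is_ideal]]
    by (simp only: mpoly_ring_simps)
  then show "mpoly_restrict W (Poly_Mapping.single a 1) \<in> ?I"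
    if "Poly_Mapping.keys a \<notin> \<Delta>" for a
    using that nonface_monomial_in_sr_ideal[of a W "complex_restrict \<Delta> W"]
    by (cases "Poly_Mapping.keys a \<subseteq> W") (simp_all add: mpoly_restrict_single complex_restrict_def)
qed

text \<open>A subset of \<open>W\<close> outside \<open>complex_restrict \<Delta> W\<close> is a
  nonface of \<open>\<Delta>\<close>, so the identity on polynomials maps generators to
  generators.\<close>

lemma ex_sr_inclusion:
  fixes \<Delta> :: "'v set set"
  assumes "W \<subseteq> V"
  shows "\<exists>\<iota> \<in> graded_alg_hom (ring_of_type_algebra :: 'k::field ring)
      (sr_ring W (complex_restrict \<Delta> W)) (sr_ring V \<Delta>).
    \<forall>p \<in> carrier (mpoly_ring W). \<iota> (sr_class W (complex_restrict \<Delta> W) p) = sr_class V \<Delta> p"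
proof (rule induced_sr_hom)
  show "(\<lambda>p. p) \<in> ring_hom (mpoly_ring W) (mpoly_ring V :: ('v, 'k) mpoly ring)"
    using assms by (intro ring_hom_memI) (auto simp: carrier_mpoly_ring)
  show "Poly_Mapping.single a 1 \<in> sr_ideal V \<Delta>"
    if "Poly_Mapping.keys a \<subseteq> W" "Poly_Mapping.keys a \<notin> complex_restrict \<Delta> W" for a
    using that assms by (intro nonface_monomial_in_sr_ideal) (auto simp: complex_restrict_def)
qed auto

lemma ring_sr_ring: "ring (sr_ring V \<Delta> :: ('k::field, ('v, 'k) mpoly set) graded_module)"
proof -
  have "ring (mpoly_ring V Quot sr_ideal V \<Delta> :: ('v, 'k) mpoly set ring)"
    by (rule ideal.quotient_is_ring[OF sr_ideal_is_ideal])
  then interpret Q: ring "mpoly_ring V Quot sr_ideal V \<Delta> :: ('v, 'k) mpoly set ring" .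
  show ?thesis
  proof (intro ringI abelian_groupI monoidI)
    fix x :: "('v, 'k) mpoly set" assume "x \<in> carrier (sr_ring V \<Delta>)"
    then show "\<exists>y\<in>carrier (sr_ring V \<Delta>). y \<oplus>\<^bsub>sr_ring V \<Delta>\<^esub> x = \<zero>\<^bsub>sr_ring V \<Delta>\<^esub>"
      using Q.l_neg Q.a_inv_closed by (fastforce simp: sr_ring_def Let_def)
  qed (simp_all add: sr_ring_def Let_def Q.a_ac Q.m_assoc Q.l_distr Q.r_distr)
qed

section \<open>Graded homomorphisms and tests on linear subsets\<close>

lemma graded_alg_homD:
  assumes "h \<in> graded_alg_hom K A B"
  shows "h \<in> ring_hom A B"
    and "\<And>c x. c \<in> carrier K \<Longrightarrow> x \<in> carrier A \<Longrightarrow> h (c \<odot>\<^bsub>A\<^esub> x) = c \<odot>\<^bsub>B\<^esub> h x"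
    and "\<And>d x. x \<in> homog A d \<Longrightarrow> h x \<in> homog B d"
  using assms by (auto simp: graded_alg_hom_def)

lemma graded_alg_hom_comp:
  assumes "f \<in> graded_alg_hom K A B" "g \<in> graded_alg_hom K B C"
  shows "g \<circ> f \<in> graded_alg_hom K A C"
  using assms ring_hom_trans[of f A B g C]
  by (auto simp: graded_alg_hom_def ring_hom_closed)

text \<open>Surjectivity in each degree, the assumption \<open>homog\<close>, makes the inverse
  degree-preserving: by injectivity the inverse sends \<open>y\<close> to its homogeneous
  preimage.\<close>

lemma graded_alg_isomorphicI:
  assumes R: "graded_algebra K R" and h: "h \<in> graded_alg_hom K R S"
    and inj: "inj_on h (carrier R)" and surj: "h ` carrier R = carrier S"
    and homog: "\<And>d. homog S d \<subseteq> h ` homog R d"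
  shows "graded_alg_isomorphic K R S"
proof -
  interpret R: graded_algebra K R by (rule R)
  have homog_carrier: "homog R d \<subseteq> carrier R" for d
    using submodule.axioms(1)[OF R.homog_submodule[of d]] subgroup.subset by fastforce
  let ?g = "inv_into (carrier R) h"
  have gh: "?g (h x) = x" if "x \<in> carrier R" for x
    using inj that by simp
  have hg: "?g y \<in> carrier R \<and> h (?g y) = y" if "y \<in> carrier S" for y
    using that surj by (metis f_inv_into_f inv_into_into)
  have "h \<in> ring_iso R S"
    using h inj surj by (auto simp: ring_iso_def bij_betw_def graded_alg_hom_def)
  then have "?g \<in> ring_hom S R"
    using ring_iso_set_sym[OF cring.axioms(1)[OF R.M_cring], of h S] unfolding ring_iso_def by simp
  moreover have "?g (c \<odot>\<^bsub>S\<^esub> y) = c \<odot>\<^bsub>R\<^esub> ?g y" if "c \<in> carrier K" "y \<in> carrier S" for c y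
    using graded_alg_homD(2)[OF h that(1), of "?g y"] gh[of "c \<odot>\<^bsub>R\<^esub> ?g y"] hg[OF that(2)] that(1)
    by simp
  moreover have "?g y \<in> homog R d" if y: "y \<in> homog S d" for y d
  proof -
    obtain r where "r \<in> homog R d" "y = h r"
      using y homog[of d] by blast
    then show ?thesis
      using gh homog_carrier[of d] by auto
  qed
  ultimately have "?g \<in> graded_alg_hom K S R"
    by (simp add: graded_alg_hom_def)
  then show ?thesis
    unfolding graded_alg_isomorphic_def using h gh hg by blast
qed

text \<open>Linear subspaces, described by closure alone with scalars from the whole type
  \<open>'k\<close>, so that the notion applies directly to the record
  \<open>sr_ring\<close>.\<close>

definition linear_subset :: "('k::field, 'a) graded_module \<Rightarrow> 'a set \<Rightarrow> bool" where
  "linear_subset A T \<longleftrightarrow> T \<subseteq> carrier A \<and> \<zero>\<^bsub>A\<^esub> \<in> T \<and> (\<forall>x\<in>T. \<forall>y\<in>T. x \<oplus>\<^bsub>A\<^esub> y \<in> T) \<and>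
    (\<forall>c. \<forall>x\<in>T. c \<odot>\<^bsub>A\<^esub> x \<in> T)"

lemma linear_subset_image:
  assumes "ring A" "ring B" and h: "h \<in> graded_alg_hom ring_of_type_algebra A B"
    and T: "linear_subset A T"
  shows "linear_subset B (h ` T)"
proof -
  note hom = graded_alg_homD(1)[OF h]
  have T': "T \<subseteq> carrier A" "\<zero>\<^bsub>A\<^esub> \<in> T" "\<And>x y. x \<in> T \<Longrightarrow> y \<in> T \<Longrightarrow> x \<oplus>\<^bsub>A\<^esub> y \<in> T"
    "\<And>c x. x \<in> T \<Longrightarrow> c \<odot>\<^bsub>A\<^esub> x \<in> T"
    using T by (auto simp: linear_subset_def)
  have "\<zero>\<^bsub>B\<^esub> \<in> h ` T"
    using ring_hom_zero[OF hom assms(1,2)] T'(2) by force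
  moreover have "h x \<oplus>\<^bsub>B\<^esub> h y \<in> h ` T" if "x \<in> T" "y \<in> T" for x y
    using ring_hom_add[OF hom, of x y] that T'(1,3) by (metis imageI subsetD)
  moreover have "c \<odot>\<^bsub>B\<^esub> h x \<in> h ` T" if "x \<in> T" for c x
    using graded_alg_homD(2)[OF h, of c x] that T'(1,4) by (metis UNIV_I imageI ring_of_type_algebra_simps(1) subsetD)
  moreover have "h ` T \<subseteq> carrier B"
    using T'(1) ring_hom_closed[OF hom] by blast
  ultimately show ?thesis
    by (auto simp: linear_subset_def)
qed

lemma linear_subset_homog:
  assumes "graded_algebra ring_of_type_algebra R"
  shows "linear_subset R (homog R d)"
proof -
  interpret graded_algebra ring_of_type_algebra R
    by (rule assms)
  interpret d: submodule "homog R d" ring_of_type_algebra R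
    by (rule homog_submodule)
  show ?thesis
    using d.subset d.one_closed d.m_closed d.smult_closed by (auto simp: linear_subset_def)
qed

lemma linear_subset_carrier_sr_ring:
  "linear_subset (sr_ring V \<Delta>) (carrier (sr_ring V \<Delta> :: ('k::field, ('v, 'k) mpoly set) graded_module))"
proof -
  interpret ring "sr_ring V \<Delta> :: ('k, ('v, 'k) mpoly set) graded_module"
    by (rule ring_sr_ring)
  have "c \<odot>\<^bsub>sr_ring V \<Delta>\<^esub> x \<in> carrier (sr_ring V \<Delta>)" if x: "x \<in> carrier (sr_ring V \<Delta>)"
    for c :: 'k and x :: "('v, 'k) mpoly set"
  proof -
    obtain p where p: "p \<in> carrier (mpoly_ring V)" "x = sr_class V \<Delta> p"
      using x by (auto simp: carrier_sr_ring)
    then show ?thesis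
      using mpoly_ring_closed(2)[OF monomial_in_mpoly_ring[of 0 V c]]
      by (auto simp: sr_ring_smult carrier_sr_ring)
  qed
  then show ?thesis
    by (auto simp: linear_subset_def)
qed

text \<open>Transfers membership in \<open>T\<close> to polynomials, where it can be tested on any
  spanning set by \<open>mpoly.span_minimal\<close>.\<close>

lemma subspace_sr_preimage:
  fixes A :: "('k::field, 'a) graded_module"
  assumes A: "ring A" and h: "h \<in> graded_alg_hom ring_of_type_algebra (sr_ring V \<Delta>) A"
    and T: "linear_subset A T"
  shows "mpoly.subspace {p \<in> carrier (mpoly_ring V). h (sr_class V \<Delta> p) \<in> T}"
proof -
  let ?F = "h \<circ> sr_class V \<Delta>"
  have F: "?F \<in> ring_hom (mpoly_ring V) A"
    using ring_hom_trans[OF sr_class_hom graded_alg_homD(1)[OF h]] .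
  have smult: "?F (Poly_Mapping.single 0 c * p) = c \<odot>\<^bsub>A\<^esub> ?F p" if "p \<in> carrier (mpoly_ring V)" for c p
    using graded_alg_homD(2)[OF h, of c "sr_class V \<Delta> p"] that
      ring_hom_closed[OF sr_class_hom[of V \<Delta>] that]
    by (simp add: sr_ring_smult)
  have const: "Poly_Mapping.single 0 c \<in> carrier (mpoly_ring V)" for c :: 'k
    by (rule monomial_in_mpoly_ring) simp
  show ?thesis
  proof (rule mpoly.subspaceI)
    show "0 \<in> {p \<in> carrier (mpoly_ring V). h (sr_class V \<Delta> p) \<in> T}"
      using ring_hom_zero[OF F cring.axioms(1)[OF cring_mpoly_ring] A] T const[of 0]
      by (simp add: linear_subset_def)
  next
    fix p q assume "p \<in> {p \<in> carrier (mpoly_ring V). h (sr_class V \<Delta> p) \<in> T}"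
      "q \<in> {p \<in> carrier (mpoly_ring V). h (sr_class V \<Delta> p) \<in> T}"
    then show "p + q \<in> {p \<in> carrier (mpoly_ring V). h (sr_class V \<Delta> p) \<in> T}"
      using ring_hom_add[OF F, of p q] T by (simp add: mpoly_ring_closed linear_subset_def)
  next
    fix c p assume "p \<in> {p \<in> carrier (mpoly_ring V). h (sr_class V \<Delta> p) \<in> T}"
    then show "Poly_Mapping.single 0 c * p \<in> {p \<in> carrier (mpoly_ring V). h (sr_class V \<Delta> p) \<in> T}"
      using smult[of p c] T const[of c] by (simp add: mpoly_ring_closed linear_subset_def)
  qed
qed

lemma sr_hom_mem_of_monomials:
  fixes A :: "('k::field, 'a) graded_module"
  assumes A: "ring A" and h: "h \<in> graded_alg_hom ring_of_type_algebra (sr_ring V \<Delta>) A"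
    and T: "linear_subset A T" and p: "p \<in> carrier (mpoly_ring V)"
    and monomials: "\<And>a. a \<in> Poly_Mapping.keys p \<Longrightarrow> h (sr_class V \<Delta> (Poly_Mapping.single a 1)) \<in> T"
  shows "h (sr_class V \<Delta> p) \<in> T"
proof -
  have "(\<lambda>a. Poly_Mapping.single a 1) ` Poly_Mapping.keys p
      \<subseteq> {p \<in> carrier (mpoly_ring V). h (sr_class V \<Delta> p) \<in> T}"
    using p monomials by (auto simp: carrier_mpoly_ring)
  from mpoly.span_minimal[OF this subspace_sr_preimage[OF A h T]] show ?thesis
    using mpoly_in_span_monomials[of p] by blast
qed

text \<open>A monomial is a product of variables, added one at a time. The family \<open>T\<close>
  is indexed by degree to cover two uses: a constant family for the image of
  \<open>\<alpha>\<close>, and the images of the graded components for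
  \<open>\<beta>\<close>.\<close>

lemma sr_hom_monomial_mem:
  fixes A :: "('k::field, 'a) graded_module"
  assumes h: "h \<in> graded_alg_hom ring_of_type_algebra (sr_ring V \<Delta>) A"
    and one: "\<one>\<^bsub>A\<^esub> \<in> T 0"
    and mult: "\<And>d x y. x \<in> T 1 \<Longrightarrow> y \<in> T d \<Longrightarrow> x \<otimes>\<^bsub>A\<^esub> y \<in> T (Suc d)"
    and var: "\<And>i. i \<in> V \<Longrightarrow>
      h (sr_class V \<Delta> (Poly_Mapping.single (Poly_Mapping.single i 1) 1)) \<in> T 1"
    and a: "Poly_Mapping.keys a \<subseteq> V"
  shows "h (sr_class V \<Delta> (Poly_Mapping.single a 1)) \<in> T (total_degree a)"
proof -
  let ?F = "h \<circ> sr_class V \<Delta>"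
  have F: "?F \<in> ring_hom (mpoly_ring V) A"
    using ring_hom_trans[OF sr_class_hom graded_alg_homD(1)[OF h]] .
  show ?thesis
    using a
  proof (induction rule: exponent_induct)
    case zero
    show ?case
      using ring_hom_one[OF F] one by (simp add: total_degree_def)
  next
    case (add a i)
    have "?F (Poly_Mapping.single (Poly_Mapping.single i 1) 1 * Poly_Mapping.single a 1)
        = ?F (Poly_Mapping.single (Poly_Mapping.single i 1) 1) \<otimes>\<^bsub>A\<^esub> ?F (Poly_Mapping.single a 1)"
      using ring_hom_mult[OF F, of "Poly_Mapping.single (Poly_Mapping.single i 1) 1"
          "Poly_Mapping.single a 1"] add.hyps
      by (simp add: monomial_in_mpoly_ring)
    then show ?case
      using mult[OF var[OF add.hyps(1)] add.IH]
      by (simp add: mult_single total_degree_add total_degree_single)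
  qed
qed

section \<open>Retracts of Stanley-Reisner rings\<close>

text \<open>Finiteness of \<open>V\<close> drives the exchange argument that produces
  \<open>W\<close>; the Noetherian hypothesis enters in the final injectivity.\<close>

theorem sr_ring_retract:
  fixes R :: "('k::field, 'r) graded_module" and V :: "'v set"
  assumes V: "finite V" and noetherian: "noetherian_ring R"
    and retract: "graded_alg_retract ring_of_type_algebra R
      (sr_ring V \<Delta> :: ('k, ('v, 'k) mpoly set) graded_module)"
  shows "\<exists>W \<subseteq> V. graded_alg_isomorphic ring_of_type_algebra R
    (sr_ring W (complex_restrict \<Delta> W) :: ('k, ('v, 'k) mpoly set) graded_module)"
proof -
  let ?K = "ring_of_type_algebra :: 'k ring" and ?P = "mpoly_ring V :: ('v, 'k) mpoly ring"
  let ?B = "sr_ring V \<Delta> :: ('k, ('v, 'k) mpoly set) graded_module"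
  let ?cB = "sr_class V \<Delta> :: ('v, 'k) mpoly \<Rightarrow> _"
  define x where "x = (\<lambda>i. Poly_Mapping.single (Poly_Mapping.single i 1) 1 :: ('v, 'k) mpoly)"
  obtain \<theta> \<phi> where R: "graded_algebra ?K R" and \<theta>: "\<theta> \<in> graded_alg_hom ?K R ?B"
    and \<phi>: "\<phi> \<in> graded_alg_hom ?K ?B R" and \<phi>\<theta>: "\<And>r. r \<in> carrier R \<Longrightarrow> \<phi> (\<theta> r) = r"
    using retract by (auto simp: graded_alg_retract_def)
  interpret R: noetherian_ring R
    by (rule noetherian)
  have linear_homog: "linear_subset R (homog R d)" for d
    by (rule linear_subset_homog[OF R])
  have homog_carrier: "homog R d \<subseteq> carrier R" for d
    using linear_homog by (simp add: linear_subset_def)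
  have x_closed: "x i \<in> carrier (mpoly_ring U)" if "i \<in> U" for i U
    using that by (simp add: x_def monomial_in_mpoly_ring)
  have B_x: "?cB (x i) \<in> homog ?B 1" if "i \<in> V" for i
    using x_closed[OF that]
    by (auto simp: homog_sr_ring homogeneous_mpoly_def x_def total_degree_single)
  have u_homog: "\<phi> (?cB (x i)) \<in> homog R 1" if "i \<in> V" for i
    by (rule graded_alg_homD(3)[OF \<phi> B_x[OF that]])
  \<comment> \<open>Both retract maps preserve degree, so the image of a variable under their
    composite is the class of a linear form.\<close>
  have "\<exists>l. \<forall>i\<in>V. l i \<in> carrier ?P \<and> homogeneous_mpoly 1 (l i) \<and> \<theta> (\<phi> (?cB (x i))) = ?cB (l i)"
  proof (rule bchoice, rule ballI)
    fix i assume "i \<in> V"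
    from graded_alg_homD(3)[OF \<theta> u_homog[OF this]]
    show "\<exists>l. l \<in> carrier ?P \<and> homogeneous_mpoly 1 l \<and> \<theta> (\<phi> (?cB (x i))) = ?cB l"
      by (auto simp: homog_sr_ring)
  qed
  then obtain l where l_closed: "\<And>i. i \<in> V \<Longrightarrow> l i \<in> carrier ?P"
    and l_homog: "\<And>i. i \<in> V \<Longrightarrow> homogeneous_mpoly 1 (l i)"
    and l: "\<And>i. i \<in> V \<Longrightarrow> \<theta> (\<phi> (?cB (x i))) = ?cB (l i)"
    by blast
  have l_span: "l i \<in> mpoly.span (x ` V)" if "i \<in> V" for i
    unfolding x_def by (rule linear_form_in_span_variables[OF l_closed[OF that] l_homog[OF that]])
  have x_eq: "l i + (x i - l i) = x i" for i
    by simp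
  \<comment> \<open>The exchange lemma with \<open>H\<close> empty and summands \<open>l i\<close>
    and \<open>x i - l i\<close>: their sums are the variables, whose span contains every
    \<open>l i\<close>.\<close>
  have "\<exists>W \<subseteq> V. (\<lambda>i. l i + (x i - l i)) ` V \<union> {} \<subseteq>
      mpoly.span (l ` W \<union> (\<lambda>i. x i - l i) ` (V - W) \<union> {})"
    unfolding x_eq
    by (rule mpoly.span_exchange_summands[OF V, where a = l and b = "\<lambda>i. x i - l i", unfolded x_eq])
      (simp only: Un_empty_right l_span)
  then obtain W where W: "W \<subseteq> V"
    and span: "x ` V \<subseteq> mpoly.span (l ` W \<union> (\<lambda>i. x i - l i) ` (V - W))"
    unfolding x_eq Un_empty_right by blast
  let ?S = "sr_ring W (complex_restrict \<Delta> W) :: ('k, ('v, 'k) mpoly set) graded_module"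
  let ?cS = "sr_class W (complex_restrict \<Delta> W) :: ('v, 'k) mpoly \<Rightarrow> _"
  obtain \<iota> where \<iota>: "\<iota> \<in> graded_alg_hom ?K ?S ?B"
    and "\<forall>p \<in> carrier (mpoly_ring W). \<iota> (?cS p) = ?cB p"
    using ex_sr_inclusion[OF W] by (rule bexE)
  then have \<iota>_class: "\<And>p. p \<in> carrier (mpoly_ring W) \<Longrightarrow> \<iota> (?cS p) = ?cB p"
    by simp
  obtain \<pi> where \<pi>: "\<pi> \<in> graded_alg_hom ?K ?B ?S"
    and "\<forall>p \<in> carrier ?P. \<pi> (?cB p) = ?cS (mpoly_restrict W p)"
    using ex_sr_restriction by (rule bexE)
  then have \<pi>_class: "\<And>p. p \<in> carrier ?P \<Longrightarrow> \<pi> (?cB p) = ?cS (mpoly_restrict W p)"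
    by simp
  define \<alpha> where "\<alpha> = \<phi> \<circ> \<iota>"
  define \<beta> where "\<beta> = \<pi> \<circ> \<theta>"
  have \<alpha>: "\<alpha> \<in> graded_alg_hom ?K ?S R" and \<beta>: "\<beta> \<in> graded_alg_hom ?K R ?S"
    unfolding \<alpha>_def \<beta>_def by (rule graded_alg_hom_comp[OF \<iota> \<phi>] graded_alg_hom_comp[OF \<theta> \<pi>])+
  note \<alpha>_hom = graded_alg_homD(1)[OF \<alpha>] and \<beta>_hom = graded_alg_homD(1)[OF \<beta>]
  have ring_S: "ring ?S"
    by (rule ring_sr_ring)

  \<comment> \<open>Since \<open>\<phi>\<close> undoes \<open>\<theta>\<close>, applying
    \<open>\<phi>\<close> to the class of \<open>l i\<close> gives back the image of
    \<open>x i\<close>; hence \<open>\<phi>\<close> kills \<open>x i - l i\<close>.\<close>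
  have \<phi>_l: "\<phi> (?cB (l i)) = \<phi> (?cB (x i))" if "i \<in> V" for i
    using \<phi>\<theta>[of "\<phi> (?cB (x i))"] u_homog[OF that] homog_carrier[of 1] l[OF that] by auto
  have \<phi>_diff: "\<phi> (?cB (x i - l i)) = \<zero>\<^bsub>R\<^esub>" if i: "i \<in> V" for i
  proof -
    have hom: "\<phi> \<circ> ?cB \<in> ring_hom ?P R"
      by (rule ring_hom_trans[OF sr_class_hom graded_alg_homD(1)[OF \<phi>]])
    have closed: "x i - l i \<in> carrier ?P"
      using i by (intro mpoly_ring_closed x_closed l_closed)
    have "\<phi> (?cB (x i)) = \<phi> (?cB (x i - l i)) \<oplus>\<^bsub>R\<^esub> \<phi> (?cB (l i))"
      using ring_hom_add[OF hom closed l_closed[OF i]] by simp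
    then show ?thesis
      using \<phi>_l[OF i] ring_hom_closed[OF hom closed] u_homog[OF i] homog_carrier[of 1]
      by (metis R.add.r_cancel_one' comp_apply subsetD)
  qed
  have \<alpha>_linear: "linear_subset R (\<alpha> ` carrier ?S)"
    by (rule linear_subset_image[OF ring_S R.ring_axioms \<alpha> linear_subset_carrier_sr_ring])
  \<comment> \<open>On the new spanning set, \<open>\<phi>\<close> takes \<open>l i\<close> with
    \<open>i \<in> W\<close> to the \<open>\<alpha>\<close>-image of a variable and
    \<open>x i - l i\<close> to zero. By linearity the images of all variables lie in the image of
    \<open>\<alpha>\<close>.\<close>
  have "l ` W \<union> (\<lambda>i. x i - l i) ` (V - W) \<subseteq> {p \<in> carrier ?P. \<phi> (?cB p) \<in> \<alpha> ` carrier ?S}"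
  proof -
    have "\<phi> (?cB (l i)) \<in> \<alpha> ` carrier ?S" if "i \<in> W" for i
    proof (rule image_eqI)
      show "\<phi> (?cB (l i)) = \<alpha> (?cS (x i))"
        using that W x_closed[OF that] by (auto simp: \<phi>_l \<alpha>_def \<iota>_class)
      show "?cS (x i) \<in> carrier ?S"
        using x_closed[OF that] by (simp add: carrier_sr_ring)
    qed
    moreover have "\<phi> (?cB (x i - l i)) \<in> \<alpha> ` carrier ?S" if "i \<in> V - W" for i
      using that \<alpha>_linear by (simp add: \<phi>_diff linear_subset_def)
    ultimately show ?thesis
      using W l_closed x_closed by (auto intro: mpoly_ring_closed)
  qed
  from mpoly.span_minimal[OF this subspace_sr_preimage[OF R.ring_axioms \<phi> \<alpha>_linear]]
  have \<alpha>_var: "\<phi> (?cB (x i)) \<in> \<alpha> ` carrier ?S" if "i \<in> V" for i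
    using span that by blast
  have \<alpha>_surj: "\<alpha> ` carrier ?S = carrier R"
  proof
    show "\<alpha> ` carrier ?S \<subseteq> carrier R"
      using \<alpha>_linear by (simp add: linear_subset_def)
    \<comment> \<open>Every \<open>r\<close> equals \<open>\<phi> (\<theta> r)\<close>, the image of
      a polynomial class, and the image of \<open>\<alpha>\<close> is linear, closed under products
      and contains the images of all variables.\<close>
    show "carrier R \<subseteq> \<alpha> ` carrier ?S"
    proof
      fix r assume r: "r \<in> carrier R"
      then obtain p where p: "p \<in> carrier ?P" "\<theta> r = ?cB p"
        using ring_hom_closed[OF graded_alg_homD(1)[OF \<theta>]] by (auto simp: carrier_sr_ring)
      have "\<phi> (?cB p) \<in> \<alpha> ` carrier ?S"
      proof (rule sr_hom_mem_of_monomials[OF R.ring_axioms \<phi> \<alpha>_linear p(1)])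
        fix a assume "a \<in> Poly_Mapping.keys p"
        then have "Poly_Mapping.keys a \<subseteq> V"
          using p(1) by (auto simp: carrier_mpoly_ring)
        then show "\<phi> (?cB (Poly_Mapping.single a 1)) \<in> \<alpha> ` carrier ?S"
        proof (rule sr_hom_monomial_mem[OF \<phi>, where T = "\<lambda>_. \<alpha> ` carrier ?S", rotated 3])
          show "\<one>\<^bsub>R\<^esub> \<in> \<alpha> ` carrier ?S"
            using ring_hom_one[OF \<alpha>_hom] ring.ring_simprules(6)[OF ring_S] by (metis imageI)
          fix y z assume "y \<in> \<alpha> ` carrier ?S" "z \<in> \<alpha> ` carrier ?S"
          then show "y \<otimes>\<^bsub>R\<^esub> z \<in> \<alpha> ` carrier ?S"
            using ring_hom_mult[OF \<alpha>_hom] ring.ring_simprules(5)[OF ring_S] by (auto simp flip: ring_hom_mult[OF \<alpha>_hom])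
        qed (rule \<alpha>_var[unfolded x_def])
      qed
      then show "r \<in> \<alpha> ` carrier ?S"
        using \<phi>\<theta>[OF r] p(2) by simp
    qed
  qed

  have \<beta>_linear: "linear_subset ?S (\<beta> ` homog R d)" for d
    by (rule linear_subset_image[OF R.ring_axioms ring_S \<beta> linear_homog])
  have \<beta>_u: "\<beta> (\<phi> (?cB (x i))) = \<pi> (?cB (l i))" if "i \<in> V" for i
    using l[OF that] by (simp add: \<beta>_def)
  \<comment> \<open>The same spanning set, tested in degree 1 for \<open>\<beta>\<close>. Each
    \<open>l i\<close> qualifies by \<open>\<beta>_u\<close>. For \<open>i \<notin> W\<close> the
    map \<open>\<pi>\<close> kills \<open>x i\<close>, so \<open>x i - l i\<close> qualifies as a
    difference.\<close>
  have "l ` W \<union> (\<lambda>i. x i - l i) ` (V - W) \<subseteq> {p \<in> carrier ?P. \<pi> (?cB p) \<in> \<beta> ` homog R 1}"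
  proof -
    note N = subspace_sr_preimage[OF ring_S \<pi> \<beta>_linear[of 1]]
    have mem: "l i \<in> {p \<in> carrier ?P. \<pi> (?cB p) \<in> \<beta> ` homog R 1}" if "i \<in> V" for i
      using that l_closed u_homog by (auto simp flip: \<beta>_u)
    have "x i - l i \<in> {p \<in> carrier ?P. \<pi> (?cB p) \<in> \<beta> ` homog R 1}" if i: "i \<in> V - W" for i
    proof -
      have "mpoly_restrict W (x i) = mpoly_restrict W 0"
        using i mpoly_restrict_eq_0[of 0 W] by (simp add: x_def mpoly_restrict_single)
      then have "\<pi> (?cB (x i)) = \<pi> (?cB 0)"
        using i x_closed[of i V] \<pi>_class[of "x i"] \<pi>_class[of 0] by (simp add: carrier_mpoly_ring)
      then have "x i \<in> {p \<in> carrier ?P. \<pi> (?cB p) \<in> \<beta> ` homog R 1}"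
        using mpoly.subspace_0[OF N] i x_closed[of i V] by simp
      then show ?thesis
        using mem[of i] i by (intro mpoly.subspace_diff[OF N]) auto
    qed
    then show ?thesis
      using mem W by blast
  qed
  from mpoly.span_minimal[OF this subspace_sr_preimage[OF ring_S \<pi> \<beta>_linear]]
  have "\<pi> (?cB (x i)) \<in> \<beta> ` homog R 1" if "i \<in> V" for i
    using span that by blast
  \<comment> \<open>For \<open>i \<in> W\<close> restriction fixes \<open>x i\<close>, so its class
    in the smaller ring has a preimage of degree 1.\<close>
  then have \<beta>_var: "?cS (x i) \<in> \<beta> ` homog R 1" if "i \<in> W" for i
    using that W \<pi>_class[OF x_closed] mpoly_restrict_id[OF x_closed[OF that]] by fastforce
  \<comment> \<open>The membership tests concern homomorphisms out of a Stanley-Reisner ring; with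
    the identity they apply to classes themselves.\<close>
  have id_hom: "(\<lambda>y. y) \<in> graded_alg_hom ?K ?S ?S"
    by (auto simp: graded_alg_hom_def intro!: ring_hom_memI)
  have \<beta>_monomial: "?cS (Poly_Mapping.single a 1) \<in> \<beta> ` homog R (int (total_degree a))"
    if "Poly_Mapping.keys a \<subseteq> W" for a
    using that
  proof (rule sr_hom_monomial_mem[OF id_hom, where T = "\<lambda>d. \<beta> ` homog R (int d)", rotated 3])
    show "\<one>\<^bsub>?S\<^esub> \<in> \<beta> ` homog R (int 0)"
      using ring_hom_one[OF \<beta>_hom] graded_algebra.homog_one[OF R] by force
  next
    fix d y z assume "y \<in> \<beta> ` homog R (int 1)" "z \<in> \<beta> ` homog R (int d)"
    then obtain r s where rs: "r \<in> homog R 1" "s \<in> homog R (int d)" "y = \<beta> r" "z = \<beta> s"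
      by auto
    then have "y \<otimes>\<^bsub>?S\<^esub> z = \<beta> (r \<otimes>\<^bsub>R\<^esub> s)"
      using ring_hom_mult[OF \<beta>_hom] homog_carrier by blast
    then show "y \<otimes>\<^bsub>?S\<^esub> z \<in> \<beta> ` homog R (int (Suc d))"
      using graded_algebra.homog_mult[OF R rs(1,2)] by simp
  qed (use \<beta>_var in \<open>simp add: x_def\<close>)
  \<comment> \<open>All monomials of a homogeneous polynomial of degree \<open>d\<close> lift to the
    same component of \<open>R\<close>, whose image is linear. This is what makes the inverse of
    \<open>\<beta>\<close> graded.\<close>
  have \<beta>_homog: "homog ?S d \<subseteq> \<beta> ` homog R d" for d
  proof
    fix y assume "y \<in> homog ?S d"
    then obtain p where p: "p \<in> carrier (mpoly_ring W)" "homogeneous_mpoly d p" "y = ?cS p"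
      by (auto simp: homog_sr_ring)
    have "?cS p \<in> \<beta> ` homog R d"
    proof (rule sr_hom_mem_of_monomials[OF ring_S id_hom \<beta>_linear p(1)])
      fix a assume "a \<in> Poly_Mapping.keys p"
      then show "?cS (Poly_Mapping.single a 1) \<in> \<beta> ` homog R d"
        using p \<beta>_monomial[of a] by (auto simp: carrier_mpoly_ring homogeneous_mpoly_def)
    qed
    then show "y \<in> \<beta> ` homog R d"
      using p(3) by simp
  qed
  have "linear_subset R (carrier R)"
    using module.smult_closed[OF algebra.module[OF graded_algebra.axioms(1)[OF R]]]
    by (auto simp: linear_subset_def)
  then have \<beta>_carrier: "linear_subset ?S (\<beta> ` carrier R)"
    by (rule linear_subset_image[OF R.ring_axioms ring_S \<beta>])
  have \<beta>_surj: "\<beta> ` carrier R = carrier ?S"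
  proof
    show "\<beta> ` carrier R \<subseteq> carrier ?S"
      using ring_hom_closed[OF \<beta>_hom] by blast
    show "carrier ?S \<subseteq> \<beta> ` carrier R"
    proof
      fix y assume "y \<in> carrier ?S"
      then obtain p where p: "p \<in> carrier (mpoly_ring W)" "y = ?cS p"
        by (auto simp: carrier_sr_ring)
      have "?cS p \<in> \<beta> ` carrier R"
      proof (rule sr_hom_mem_of_monomials[OF ring_S id_hom \<beta>_carrier p(1)])
        fix a assume "a \<in> Poly_Mapping.keys p"
        then have "?cS (Poly_Mapping.single a 1) \<in> \<beta> ` homog R (int (total_degree a))"
          using p(1) by (intro \<beta>_monomial) (auto simp: carrier_mpoly_ring)
        then show "?cS (Poly_Mapping.single a 1) \<in> \<beta> ` carrier R"
          using homog_carrier by blast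
      qed
      then show "y \<in> \<beta> ` carrier R"
        using p(2) by simp
    qed
  qed

  \<comment> \<open>The composite is taken on \<open>R\<close>, the ring assumed Noetherian; its
    injectivity passes to the inner map \<open>\<beta>\<close>.\<close>
  have "inj_on (\<alpha> \<circ> \<beta>) (carrier R)"
    using ring_hom_trans[OF \<beta>_hom \<alpha>_hom] \<alpha>_surj \<beta>_surj
    by (intro R.surj_ring_endomorphism_inj) (simp_all only: image_comp[symmetric])
  then have "inj_on \<beta> (carrier R)"
    by (rule inj_on_imageI2)
  then have "graded_alg_isomorphic ?K R ?S"
    using graded_alg_isomorphicI[OF R \<beta> _ \<beta>_surj \<beta>_homog] by blast
  then show ?thesis
    using W by blast
qed

theorem corollary5p10:
  fixes n :: nat
    and \<Delta> :: "nat set set"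
    and R :: "('k::field, 'r) graded_module"
  assumes "simplicial_complex_on {1..n} \<Delta>"
    and "noetherian_ring R"
    and "\<one>\<^bsub>R\<^esub> \<noteq> \<zero>\<^bsub>R\<^esub>"
    and "graded_alg_retract ring_of_type_algebra R
          (sr_ring {1..n} \<Delta> :: ('k, (nat, 'k) mpoly set) graded_module)"
  shows "\<exists>W \<subseteq> {1..n}.
    graded_alg_isomorphic ring_of_type_algebra R
      (sr_ring W (complex_restrict \<Delta> W) :: ('k, (nat, 'k) mpoly set) graded_module)"
  using sr_ring_retract[OF _ assms(2,4)] by simp

end
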